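(* For every positive integer $n$, $\boldsymbol{H}(n)$ implies $\boldsymbol{H}'(n-2)$. Here $\boldsymbol{H}(n)$ is the assertion: for every pair of finite graphs $G$ and $H$, $\chi(G\times H)=n$ implies $\min\{\chi(G),\chi(H)\}=n$; and, for an integer $m$, $\boldsymbol{H}'(m)$ is the assertion: for every pair of finite $\mathbb{Z}_2$-CW-complexes $X$ and $Y$, $\mathrm{ind}(X\times Y)=m$ implies $\min\{\mathrm{ind}(X),\mathrm{ind}(Y)\}=m$. Therefore, if Hedetniemi's conjecture is true (that is, if $\chi(G\times H)=\min\{\chi(G),\chi(H)\}$ for every pair of finite graphs $G$ and $H$), then $\mathrm{ind}(X\times Y)=\min\{\mathrm{ind}(X),\mathrm{ind}(Y)\}$ for every pair of finite $\mathbb{Z}_2$-CW-complexes $X$ and $Y$.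
   Context: A graph $G=(V(G),E(G))$ consists of a finite set $V(G)$ and a symmetric subset $E(G)\subset V(G)\times V(G)$ (loops are allowed). A graph homomorphism $G\to H$ is a map $f:V(G)\to V(H)$ such that $(v,w)\in E(G)$ implies $(f(v),f(w))\in E(H)$. $K_n$ is the graph with vertex set $\{1,\dots,n\}$ and edge set $\{(i,j): i\neq j\}$. The chromatic number $\chi(G)$ is the smallest $n$ such that there is a graph homomorphism $G\to K_n$ ($\chi(G)=\infty$ if $G$ has a looped vertex). The tensor product $G\times H$ has vertex set $V(G)\times V(H)$ and edge set $\{((v,w),(v',w')) : (v,v')\in E(G),\ (w,w')\in E(H)\}$. A $\mathbb{Z}_2$-map is a continuous $\mathbb{Z}_2$-equivariant map. $S^n$ is a $\mathbb{Z}_2$-space via the antipodal map, with the convention $S^{-1}=\emptyset$. For a $\mathbb{Z}_2$-CW-complex $X$, the $\mathbb{Z}_2$-index $\mathrm{ind}(X)$ is the smallest integer $n\ge -1$ such that there is a $\mathbb{Z}_2$-map $X\to S^n$, and $\mathrm{ind}(X)=\infty$ if no such $n$ exists. The product $X\times Y$ carries the diagonal $\mathbb{Z}_2$-action. *)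

theory Defs
  imports "HOL-Analysis.Analysis" "HOL-Library.Extended_Nat" "HOL-Library.Extended_Real"
begin

section \<open>Graphs\<close>

record 'v graph =
  verts :: "'v set"
  edges :: "('v \<times> 'v) set"

definition finite_graph :: "'v graph \<Rightarrow> bool" where
  "finite_graph G \<longleftrightarrow> finite (verts G) \<and> edges G \<subseteq> verts G \<times> verts G \<and> sym (edges G)"

definition graph_hom :: "'v graph \<Rightarrow> 'w graph \<Rightarrow> ('v \<Rightarrow> 'w) \<Rightarrow> bool" where
  "graph_hom G H f \<longleftrightarrow>
     f ` verts G \<subseteq> verts H \<and> (\<forall>(v, w) \<in> edges G. (f v, f w) \<in> edges H)"

definition complete_graph :: "nat \<Rightarrow> nat graph" where
  "complete_graph n =
     \<lparr>verts = {1..n}, edges = {(i, j). i \<in> {1..n} \<and> j \<in> {1..n} \<and> i \<noteq> j}\<rparr>"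

text \<open>The infimum of the empty set in \<^typ>\<open>enat\<close> is \<open>\<infinity>\<close>, and a nonempty
  infimum is attained (see \<open>chromatic_number_eq_iff\<close>).\<close>

definition chromatic_number :: "'v graph \<Rightarrow> enat" where
  "chromatic_number G = Inf {enat n | n. \<exists>f. graph_hom G (complete_graph n) f}"

definition tensor_product :: "'v graph \<Rightarrow> 'w graph \<Rightarrow> ('v \<times> 'w) graph" where
  "tensor_product G H =
     \<lparr>verts = verts G \<times> verts H,
      edges = {((v, w), (v', w')). (v, v') \<in> edges G \<and> (w, w') \<in> edges H}\<rparr>"

text \<open>Every finite graph is isomorphic to one whose vertices are natural numbers, so quantifying over
  \<^typ>\<open>nat graph\<close> covers all finite graphs; \<open>hedetniemi_at_any_type\<close> and \<open>hedetniemi_conjecture_any_type\<close>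
  below give the instances for arbitrary vertex types.\<close>

definition hedetniemi_at :: "nat \<Rightarrow> bool" where
  "hedetniemi_at n \<longleftrightarrow>
     (\<forall>(G :: nat graph) (H :: nat graph). finite_graph G \<longrightarrow> finite_graph H \<longrightarrow>
        chromatic_number (tensor_product G H) = enat n \<longrightarrow>
        min (chromatic_number G) (chromatic_number H) = enat n)"

definition hedetniemi_conjecture :: bool where
  "hedetniemi_conjecture \<longleftrightarrow>
     (\<forall>(G :: nat graph) (H :: nat graph). finite_graph G \<longrightarrow> finite_graph H \<longrightarrow>
        chromatic_number (tensor_product G H) = min (chromatic_number G) (chromatic_number H))"


section \<open>Spaces with an involution\<close>

text \<open>A \<open>\<int>\<^sub>2\<close>-space is given by a topology and the action of the nontrivial element of \<open>\<int>\<^sub>2\<close>.\<close>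

definition Z2_space :: "'a topology \<Rightarrow> ('a \<Rightarrow> 'a) \<Rightarrow> bool" where
  "Z2_space X \<tau> \<longleftrightarrow> continuous_map X X \<tau> \<and> (\<forall>x \<in> topspace X. \<tau> (\<tau> x) = x)"

definition Z2_map ::
    "'a topology \<Rightarrow> ('a \<Rightarrow> 'a) \<Rightarrow> 'b topology \<Rightarrow> ('b \<Rightarrow> 'b) \<Rightarrow> ('a \<Rightarrow> 'b) \<Rightarrow> bool" where
  "Z2_map X \<tau> Y \<sigma> f \<longleftrightarrow> continuous_map X Y f \<and> (\<forall>x \<in> topspace X. f (\<tau> x) = \<sigma> (f x))"

definition sphere_top :: "int \<Rightarrow> (nat \<Rightarrow> real) topology" where
  "sphere_top n = (if n < 0 then trivial_topology else nsphere (nat n))"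

definition antipode :: "(nat \<Rightarrow> real) \<Rightarrow> (nat \<Rightarrow> real)" where
  "antipode x = (\<lambda>i. - x i)"

text \<open>As for \<open>chromatic_number\<close>, the infimum over the empty set is \<open>\<infinity>\<close>, and otherwise the
  infimum is a minimum (see \<open>Z2_index_eq_iff\<close>).\<close>

definition Z2_index :: "'a topology \<Rightarrow> ('a \<Rightarrow> 'a) \<Rightarrow> ereal" where
  "Z2_index X \<tau> =
     Inf {ereal (of_int n) | n. n \<ge> -1 \<and> (\<exists>f. Z2_map X \<tau> (sphere_top n) antipode f)}"


section \<open>Finite \<open>\<int>\<^sub>2\<close>-CW-complexes\<close>

definition disc_top :: "nat \<Rightarrow> (nat \<Rightarrow> real) topology" where
  "disc_top n = subtopology (Euclidean_space n) {x. (\<Sum>i<n. x i ^ 2) \<le> 1}"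

definition disc_interior :: "nat \<Rightarrow> (nat \<Rightarrow> real) set" where
  "disc_interior n = {x \<in> topspace (disc_top n). (\<Sum>i<n. x i ^ 2) < 1}"

definition disc_boundary :: "nat \<Rightarrow> (nat \<Rightarrow> real) set" where
  "disc_boundary n = {x \<in> topspace (disc_top n). (\<Sum>i<n. x i ^ 2) = 1}"

text \<open>An equivariant cell has the form \<open>\<int>\<^sub>2/H \<times> D\<^sup>n\<close> for a subgroup \<open>H\<close> of \<open>\<int>\<^sub>2\<close>. The flag
  \<open>cell_free\<close> says that \<open>H\<close> is trivial; then \<open>\<int>\<^sub>2/H\<close> is the two-point set \<^typ>\<open>bool\<close> with the swap
  action. Otherwise \<open>H = \<int>\<^sub>2\<close> and \<open>\<int>\<^sub>2/H\<close> is a point.\<close>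

definition Z2_orbit :: "bool \<Rightarrow> bool set" where
  "Z2_orbit free = (if free then UNIV else {False})"

definition Z2_orbit_act :: "bool \<Rightarrow> bool \<Rightarrow> bool" where
  "Z2_orbit_act free = (if free then Not else id)"

record 'a Z2_cell =
  cell_free :: bool
  cell_dim :: nat
  cell_map :: "bool \<times> (nat \<Rightarrow> real) \<Rightarrow> 'a"

definition cell_domain :: "'a Z2_cell \<Rightarrow> (bool \<times> (nat \<Rightarrow> real)) topology" where
  "cell_domain c =
     prod_topology (discrete_topology (Z2_orbit (cell_free c))) (disc_top (cell_dim c))"

definition open_cell :: "'a Z2_cell \<Rightarrow> 'a set" where
  "open_cell c = cell_map c ` (Z2_orbit (cell_free c) \<times> disc_interior (cell_dim c))"

text \<open>Whitehead's description of a CW structure by characteristic maps, with equivariant cells.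
  Since there are finitely many cells and the space is Hausdorff, closure-finiteness, the weak
  topology, and the fact that the characteristic maps are homeomorphisms from the interiors of
  their domains onto the open cells are automatic.\<close>

definition Z2_CW_structure :: "'a topology \<Rightarrow> ('a \<Rightarrow> 'a) \<Rightarrow> 'a Z2_cell set \<Rightarrow> bool" where
  "Z2_CW_structure X \<tau> C \<longleftrightarrow>
     finite C \<and>
     (\<forall>c \<in> C.
        Z2_map (cell_domain c) (map_prod (Z2_orbit_act (cell_free c)) id) X \<tau> (cell_map c) \<and>
        inj_on (cell_map c) (Z2_orbit (cell_free c) \<times> disc_interior (cell_dim c)) \<and>
        cell_map c ` (Z2_orbit (cell_free c) \<times> disc_boundary (cell_dim c))
          \<subseteq> \<Union> (open_cell ` {c' \<in> C. cell_dim c' < cell_dim c})) \<and>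
     disjoint_family_on open_cell C \<and>
     \<Union> (open_cell ` C) = topspace X"

definition finite_Z2_CW_complex :: "'a topology \<Rightarrow> ('a \<Rightarrow> 'a) \<Rightarrow> bool" where
  "finite_Z2_CW_complex X \<tau> \<longleftrightarrow>
     Z2_space X \<tau> \<and> Hausdorff_space X \<and> (\<exists>C. Z2_CW_structure X \<tau> C)"

text \<open>The type arguments are the carrier types of the two complexes; a theorem that is polymorphic
  in them speaks about all complexes.\<close>

definition index_hedetniemi_at :: "'a itself \<Rightarrow> 'b itself \<Rightarrow> int \<Rightarrow> bool" where
  "index_hedetniemi_at A B m \<longleftrightarrow>
     (\<forall>(X :: 'a topology) \<tau> (Y :: 'b topology) \<sigma>.
        finite_Z2_CW_complex X \<tau> \<longrightarrow> finite_Z2_CW_complex Y \<sigma> \<longrightarrow>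
        Z2_index (prod_topology X Y) (map_prod \<tau> \<sigma>) = ereal (of_int m) \<longrightarrow>
        min (Z2_index X \<tau>) (Z2_index Y \<sigma>) = ereal (of_int m))"


section \<open>Checks of the conventions\<close>

lemma chromatic_number_eq_iff:
  "chromatic_number G = enat n \<longleftrightarrow>
     (\<exists>f. graph_hom G (complete_graph n) f) \<and>
     (\<forall>m<n. \<nexists>f. graph_hom G (complete_graph m) f)"
proof -
  let ?P = "\<lambda>n. \<exists>f. graph_hom G (complete_graph n) f"
  have eq: "chromatic_number G = Inf (enat ` {n. ?P n})"
    unfolding chromatic_number_def by (rule arg_cong[where f = Inf]) auto
  show ?thesis
  proof (cases "\<exists>n. ?P n")
    case True
    have "Inf (enat ` {n. ?P n}) = enat (LEAST n. ?P n)"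
    proof (rule antisym)
      show "Inf (enat ` {n. ?P n}) \<le> enat (LEAST n. ?P n)"
        using LeastI_ex[OF True] by (intro Inf_lower) auto
      show "enat (LEAST n. ?P n) \<le> Inf (enat ` {n. ?P n})"
        using Least_le[where P = ?P] by (intro Inf_greatest) fastforce
    qed
    then have "chromatic_number G = enat n \<longleftrightarrow> (LEAST n. ?P n) = n"
      using eq by simp
    also have "\<dots> \<longleftrightarrow> ?P n \<and> (\<forall>m<n. \<not> ?P m)"
    proof
      assume "(LEAST n. ?P n) = n"
      then show "?P n \<and> (\<forall>m<n. \<not> ?P m)"
        using LeastI_ex[OF True] not_less_Least[where P = ?P] by metis
    next
      assume "?P n \<and> (\<forall>m<n. \<not> ?P m)"
      then show "(LEAST n. ?P n) = n"
        by (intro Least_equality) (auto simp: not_less[symmetric])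
    qed
    finally show ?thesis .
  next
    case False
    then show ?thesis using eq by (simp add: Inf_enat_def)
  qed
qed

lemma Z2_index_eq_iff:
  "Z2_index X \<tau> = ereal (of_int n) \<longleftrightarrow>
     n \<ge> -1 \<and> (\<exists>f. Z2_map X \<tau> (sphere_top n) antipode f) \<and>
     (\<forall>m. -1 \<le> m \<and> m < n \<longrightarrow> (\<nexists>f. Z2_map X \<tau> (sphere_top m) antipode f))"
proof -
  define P where "P = (\<lambda>n. n \<ge> -1 \<and> (\<exists>f. Z2_map X \<tau> (sphere_top n) antipode f))"
  have eq: "Z2_index X \<tau> = Inf {ereal (of_int n) | n. P n}"
    by (simp add: Z2_index_def P_def)
  have val: "Z2_index X \<tau> = ereal (of_int k)" if k: "P k" "\<forall>m<k. \<not> P m" for k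
    unfolding eq
  proof (rule antisym)
    show "Inf {ereal (of_int n) | n. P n} \<le> ereal (of_int k)"
      using k by (intro Inf_lower) auto
    show "ereal (of_int k) \<le> Inf {ereal (of_int n) | n. P n}"
      using k by (intro Inf_greatest) (auto simp: not_less[symmetric])
  qed
  have "Z2_index X \<tau> = ereal (of_int n) \<longleftrightarrow> P n \<and> (\<forall>m<n. \<not> P m)"
  proof
    assume n: "Z2_index X \<tau> = ereal (of_int n)"
    have "\<exists>k. P k"
    proof (rule ccontr)
      assume "\<nexists>k. P k"
      then have "Z2_index X \<tau> = \<infinity>" unfolding eq by (simp add: top_ereal_def)
      with n show False by simp
    qed
    then obtain k0 where k0: "P k0" by blast
    define j where "j = (LEAST j. P (int j - 1))"
    have ex: "P (int (nat (k0 + 1)) - 1)"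
      using k0 by (auto simp: P_def)
    have j: "P (int j - 1)" unfolding j_def by (rule LeastI[where P = "\<lambda>j. P (int j - 1)", OF ex])
    have "\<not> P m" if "m < int j - 1" for m
    proof
      assume m: "P m"
      then have "P (int (nat (m + 1)) - 1)" by (auto simp: P_def)
      then have "j \<le> nat (m + 1)" unfolding j_def by (rule Least_le)
      with that m show False by (auto simp: P_def)
    qed
    with j have "Z2_index X \<tau> = ereal (of_int (int j - 1))" by (intro val) auto
    with n have "n = int j - 1" by (metis ereal.inject of_int_eq_iff)
    with j \<open>\<And>m. m < int j - 1 \<Longrightarrow> \<not> P m\<close> show "P n \<and> (\<forall>m<n. \<not> P m)" by blast
  qed (use val in blast)
  then show ?thesis by (auto simp: P_def)
qed

lemma graph_hom_compose:
  assumes "graph_hom G H f" "graph_hom H K g"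
  shows "graph_hom G K (g \<circ> f)"
  using assms unfolding graph_hom_def by (fastforce simp: image_subset_iff)

lemma chromatic_number_mono:
  assumes "graph_hom G H f"
  shows "chromatic_number G \<le> chromatic_number H"
  unfolding chromatic_number_def
  by (rule Inf_superset_mono) (use graph_hom_compose[OF assms] in blast)

lemma graph_hom_tensor_product:
  assumes "graph_hom G G' f" "graph_hom H H' g"
  shows "graph_hom (tensor_product G H) (tensor_product G' H') (map_prod f g)"
  using assms unfolding graph_hom_def tensor_product_def by fastforce

lemma finite_graph_nat_copy:
  fixes G :: "'v graph"
  assumes "finite_graph G"
  obtains G' :: "nat graph" and f g
  where "finite_graph G'" "graph_hom G G' f" "graph_hom G' G g"
proof -
  obtain f :: "'v \<Rightarrow> nat" where f: "inj_on f (verts G)"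
    using assms finite_imp_inj_to_nat_seg unfolding finite_graph_def by metis
  define G' where "G' = \<lparr>verts = f ` verts G, edges = map_prod f f ` edges G\<rparr>"
  have "finite_graph G'"
    using assms unfolding finite_graph_def G'_def sym_def by fastforce
  moreover have "graph_hom G G' f"
    unfolding graph_hom_def G'_def by auto
  moreover have "graph_hom G' G (inv_into (verts G) f)"
    using assms f unfolding graph_hom_def G'_def finite_graph_def
    by (auto simp: inv_into_f_f[OF f] dest!: subsetD)
  ultimately show thesis using that by blast
qed

lemma chromatic_number_nat_copies:
  fixes G :: "'v graph" and H :: "'w graph"
  assumes "finite_graph G" "finite_graph H"
  obtains G' H' :: "nat graph"
  where "finite_graph G'" "finite_graph H'"
    "chromatic_number G' = chromatic_number G" "chromatic_number H' = chromatic_number H"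
    "chromatic_number (tensor_product G' H') = chromatic_number (tensor_product G H)"
proof -
  obtain G' :: "nat graph" and f f' where
    G: "finite_graph G'" "graph_hom G G' f" "graph_hom G' G f'"
    using finite_graph_nat_copy[OF assms(1)] by blast
  obtain H' :: "nat graph" and g g' where
    H: "finite_graph H'" "graph_hom H H' g" "graph_hom H' H g'"
    using finite_graph_nat_copy[OF assms(2)] by blast
  show thesis
    by (rule that[of G' H'])
       (use G H in \<open>blast intro: antisym chromatic_number_mono graph_hom_tensor_product\<close>)+
qed

lemma hedetniemi_at_any_type:
  fixes G :: "'v graph" and H :: "'w graph"
  assumes "hedetniemi_at n" "finite_graph G" "finite_graph H"
    and "chromatic_number (tensor_product G H) = enat n"
  shows "min (chromatic_number G) (chromatic_number H) = enat n"
  using chromatic_number_nat_copies[OF assms(2,3)] assms(1,4)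
  unfolding hedetniemi_at_def by metis

lemma hedetniemi_conjecture_any_type:
  fixes G :: "'v graph" and H :: "'w graph"
  assumes "hedetniemi_conjecture" "finite_graph G" "finite_graph H"
  shows "chromatic_number (tensor_product G H) = min (chromatic_number G) (chromatic_number H)"
  using chromatic_number_nat_copies[OF assms(2,3)] assms(1)
  unfolding hedetniemi_conjecture_def by metis

end

theory Submission
  imports Defs
begin

text \<open>
  Cover \<open>X\<close> by finitely many cozero sets \<open>U\<^sub>j\<close> and join \<open>i\<close> to \<open>j\<close> when \<open>U\<^sub>i\<close> meets
  \<open>\<tau> U\<^sub>j\<close>. A colouring of this graph with \<open>k\<close> colours turns the cover into \<open>k\<close> cozero sets, none of
  which contains both \<open>x\<close> and \<open>\<tau> x\<close>; antisymmetrizing the functions that define them gives a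
  \<open>\<int>\<^sub>2\<close>-map to \<open>S\<^bsup>k-2\<^esup>\<close>. The tensor product of two such graphs is the graph of the product cover.
  Conversely, a \<open>\<int>\<^sub>2\<close>-map \<open>X \<times> Y \<rightarrow> S\<^sup>m\<close> yields an \<open>(m + 2)\<close>-colouring of the product graph when
  the covers of \<open>X\<close> and \<open>Y\<close> are fine enough. So if \<open>X \<times> Y\<close> has index \<open>m \<ge> 0\<close>, the product graph has
  chromatic number exactly \<open>m + 2\<close>, hence so has one factor, and \<open>X\<close> or \<open>Y\<close> maps to \<open>S\<^sup>m\<close>.
  Of the CW structure only compactness and the Hausdorff property matter.
\<close>

section \<open>Compactness of finite equivariant complexes\<close>

text \<open>The disc is closed in the countable power of the real line and lies in the cube with
  sides \<open>{-1..1}\<close>, which is compact by Tychonoff.\<close>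

lemma compact_space_disc_top: "compact_space (disc_top n)"
proof -
  let ?E = "powertop_real UNIV"
  let ?B = "{x \<in> topspace ?E. (\<Sum>i<n. x i ^ 2) \<in> {..1}}"
  let ?A = "topspace (Euclidean_space n)"
  have "continuous_map ?E euclideanreal (\<lambda>x. \<Sum>i<n. x i ^ 2)"
    by (intro continuous_intros) auto
  then have "closedin ?E ?B"
    by (rule closedin_continuous_map_preimage) simp
  then have closed: "closedin ?E (?A \<inter> ?B)"
    by (intro closedin_Int closedin_Euclidean_space)
  have "x i \<in> {-1..1}" if "x \<in> ?A \<inter> ?B" for x i
  proof (cases "i < n")
    case True
    then have "(x i)\<^sup>2 \<le> (\<Sum>i<n. x i ^ 2)"
      by (intro member_le_sum) auto
    also have "\<dots> \<le> 1"
      using that by simp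
    finally show ?thesis
      by (simp add: abs_square_le_1 abs_le_iff)
  next
    case False
    with that show ?thesis
      by (simp add: topspace_Euclidean_space)
  qed
  then have "?A \<inter> ?B \<subseteq> (\<Pi>\<^sub>E i\<in>UNIV. {-1..1})"
    by blast
  moreover have "compactin ?E (\<Pi>\<^sub>E i\<in>UNIV. {-1..1})"
    by (simp add: compactin_PiE)
  ultimately have "compactin ?E (?A \<inter> ?B)"
    using closed closed_compactin by blast
  then have "compact_space (subtopology ?E (?A \<inter> ?B))"
    by (simp add: compact_space_subtopology)
  moreover have "disc_top n = subtopology ?E (?A \<inter> ?B)"
    by (simp add: disc_top_def Euclidean_space_def subtopology_subtopology)
  ultimately show ?thesis by simp
qed

text \<open>The space is a finite union of continuous images of the cell domains, each a finite
  discrete orbit times a compact disc.\<close>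

lemma compact_space_finite_Z2_CW_complex:
  assumes "finite_Z2_CW_complex X \<tau>"
  shows "compact_space X"
proof -
  obtain C where C: "Z2_CW_structure X \<tau> C"
    using assms unfolding finite_Z2_CW_complex_def by blast
  let ?K = "\<lambda>c. cell_map c ` topspace (cell_domain c)"
  have map: "continuous_map (cell_domain c) X (cell_map c)" if "c \<in> C" for c
    using C that unfolding Z2_CW_structure_def Z2_map_def by blast
  have "compact_space (cell_domain c)" for c :: "'a Z2_cell"
    unfolding cell_domain_def
    by (simp add: compact_space_prod_topology compact_space_disc_top compact_space_discrete_topology)
  then have "compactin X (?K c)" if "c \<in> C" for c
    using map[OF that] image_compactin compact_space_def by metis
  then have "compactin X (\<Union> (?K ` C))"
    using C by (intro compactin_Union) (auto simp: Z2_CW_structure_def)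
  moreover have "open_cell c \<subseteq> ?K c" for c :: "'a Z2_cell"
    unfolding open_cell_def cell_domain_def disc_interior_def by auto
  then have "topspace X \<subseteq> \<Union> (?K ` C)"
    using C unfolding Z2_CW_structure_def by blast
  moreover have "\<Union> (?K ` C) \<subseteq> topspace X"
    using map by (blast dest: continuous_map_image_subset_topspace)
  ultimately show ?thesis
    unfolding compact_space_def by (metis subset_antisym)
qed

lemma compact_Hausdorff_imp_completely_regular_space:
  assumes "compact_space X" "Hausdorff_space X"
  shows "completely_regular_space X"
  using assms compact_Hausdorff_or_regular_imp_normal_space normal_imp_completely_regular_space
  by blast

section \<open>Equivariant maps and monotonicity of the index\<close>

lemma Z2_space_prod_topology:
  assumes "Z2_space X \<tau>" "Z2_space Y \<sigma>"
  shows "Z2_space (prod_topology X Y) (map_prod \<tau> \<sigma>)"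
proof -
  have "continuous_map (prod_topology X Y) (prod_topology X Y) (\<lambda>(x, y). (\<tau> x, \<sigma> y))"
    using assms by (simp add: Z2_space_def continuous_map_prod_top)
  then show ?thesis
    using assms by (auto simp: Z2_space_def map_prod_def)
qed

lemma Z2_map_fst: "Z2_map (prod_topology X Y) (map_prod \<tau> \<sigma>) X \<tau> fst"
  by (auto simp: Z2_map_def continuous_map_fst)

lemma Z2_map_snd: "Z2_map (prod_topology X Y) (map_prod \<tau> \<sigma>) Y \<sigma> snd"
  by (auto simp: Z2_map_def continuous_map_snd)

lemma Z2_map_compose:
  assumes "Z2_map X \<tau> Y \<sigma> f" "Z2_map Y \<sigma> Z \<rho> g"
  shows "Z2_map X \<tau> Z \<rho> (g \<circ> f)"
  using assms unfolding Z2_map_def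
  by (auto intro: continuous_map_compose dest: continuous_map_image_subset_topspace)

lemma Z2_index_mono:
  assumes "Z2_map X \<tau> Y \<sigma> f"
  shows "Z2_index X \<tau> \<le> Z2_index Y \<sigma>"
  unfolding Z2_index_def
  by (rule Inf_superset_mono) (use Z2_map_compose[OF assms] in blast)

lemma Z2_index_prod_le:
  "Z2_index (prod_topology X Y) (map_prod \<tau> \<sigma>) \<le> min (Z2_index X \<tau>) (Z2_index Y \<sigma>)"
  using Z2_index_mono[OF Z2_map_fst] Z2_index_mono[OF Z2_map_snd] by (metis min.bounded_iff)

lemma Z2_index_le:
  assumes "Z2_map X \<tau> (sphere_top m) antipode f" "m \<ge> -1"
  shows "Z2_index X \<tau> \<le> ereal (of_int m)"
  unfolding Z2_index_def using assms by (intro Inf_lower) blast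

lemma Z2_index_cases:
  obtains m where "m \<ge> -1" "Z2_index X \<tau> = ereal (of_int m)" | "Z2_index X \<tau> = \<infinity>"
proof (cases "\<exists>n. n \<ge> -1 \<and> (\<exists>f. Z2_map X \<tau> (sphere_top n) antipode f)")
  case True
  \<comment> \<open>Shifting by one lets the natural number 0 stand for the sphere of dimension -1,
    so that a least element exists by well-ordering.\<close>
  define P where "P k \<longleftrightarrow> (\<exists>f. Z2_map X \<tau> (sphere_top (int k - 1)) antipode f)" for k
  have "\<exists>k. P k"
  proof -
    from True obtain n f where "n \<ge> -1" "Z2_map X \<tau> (sphere_top n) antipode f" by blast
    then have "P (nat (n + 1))" unfolding P_def by auto
    then show ?thesis ..
  qed
  then have k: "P (LEAST k. P k)"
    by (rule LeastI_ex)
  have "\<not> P (nat (m + 1))" if "m < int (LEAST k. P k) - 1" "m \<ge> -1" for m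
    using that by (intro not_less_Least) linarith
  then have "\<nexists>f. Z2_map X \<tau> (sphere_top m) antipode f"
    if "m < int (LEAST k. P k) - 1" "m \<ge> -1" for m
    using that by (simp add: P_def)
  then have "Z2_index X \<tau> = ereal (of_int (int (LEAST k. P k) - 1))"
    unfolding Z2_index_eq_iff using k[unfolded P_def[of "LEAST k. P k"]] by simp
  then show thesis using that(1)[of "int (LEAST k. P k) - 1"] by auto
next
  case False
  then have *: "{ereal (of_int n) |n. n \<ge> -1 \<and> (\<exists>f. Z2_map X \<tau> (sphere_top n) antipode f)} = {}"
    by blast
  show thesis
    by (rule that(2), unfold Z2_index_def *) (simp add: top_ereal_def)
qed

text \<open>Dividing by the Euclidean norm, which is positive and invariant under
  \<open>\<tau>\<close>, puts the vector of the \<open>z i\<close> on the sphere.\<close>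

lemma odd_functions_imp_Z2_map_to_sphere:
  assumes cont: "\<And>i. i \<le> n \<Longrightarrow> continuous_map X euclideanreal (z i)"
    and odd: "\<And>i x. i \<le> n \<Longrightarrow> x \<in> topspace X \<Longrightarrow> z i (\<tau> x) = - z i x"
    and nonzero: "\<And>x. x \<in> topspace X \<Longrightarrow> \<exists>i\<le>n. z i x \<noteq> 0"
  obtains f where "Z2_map X \<tau> (sphere_top (int n)) antipode f"
proof -
  define r where "r x = sqrt (\<Sum>i\<le>n. (z i x)\<^sup>2)" for x
  define f where "f x = (\<lambda>i. if i \<le> n then z i x / r x else 0)" for x
  have r: "r x > 0" if "x \<in> topspace X" for x
  proof -
    obtain i where "i \<le> n" "z i x \<noteq> 0"
      using nonzero[OF \<open>x \<in> topspace X\<close>] by blast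
    then have "(\<Sum>i\<le>n. (z i x)\<^sup>2) > 0"
      by (intro sum_pos2[where i = i]) auto
    then show ?thesis
      by (simp add: r_def)
  qed
  have "continuous_map X euclideanreal r"
    unfolding r_def using cont by (intro continuous_intros) auto
  then have "continuous_map X euclideanreal (\<lambda>x. f x i)" for i
    unfolding f_def using cont r by (cases "i \<le> n") (auto intro!: continuous_intros less_imp_neq[symmetric])
  moreover have "(\<Sum>i\<le>n. (f x i)\<^sup>2) = 1" if "x \<in> topspace X" for x
  proof -
    have "(\<Sum>i\<le>n. (f x i)\<^sup>2) = (\<Sum>i\<le>n. (z i x)\<^sup>2) / (r x)\<^sup>2"
      by (simp add: f_def power_divide sum_divide_distrib)
    also have "(r x)\<^sup>2 = (\<Sum>i\<le>n. (z i x)\<^sup>2)"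
      by (simp add: r_def sum_nonneg)
    finally show ?thesis
      using r[OF that] by (simp add: r_def)
  qed
  ultimately have "continuous_map X (sphere_top (int n)) f"
    unfolding sphere_top_def nsphere
    by (auto simp: continuous_map_in_subtopology continuous_map_componentwise_UNIV f_def)
  moreover have "f (\<tau> x) = antipode (f x)" if "x \<in> topspace X" for x
  proof -
    have "r (\<tau> x) = r x"
      using odd that by (simp add: r_def)
    then show ?thesis
      using odd that by (auto simp: f_def antipode_def)
  qed
  ultimately show thesis
    using that unfolding Z2_map_def by blast
qed

section \<open>Cozero covers, their graphs and colourings\<close>

text \<open>The open sets are recorded by functions not vanishing on them: products then describe
  boxes and sums of squares describe unions.\<close>

definition cozero_cover :: "'a topology \<Rightarrow> 'i set \<Rightarrow> ('i \<Rightarrow> 'a \<Rightarrow> real) \<Rightarrow> bool" where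
  "cozero_cover X J h \<longleftrightarrow> finite J \<and> (\<forall>j\<in>J. continuous_map X euclideanreal (h j)) \<and>
     (\<forall>x\<in>topspace X. \<exists>j\<in>J. h j x \<noteq> 0)"

text \<open>A combinatorial substitute for the Borsuk graph of \<open>X\<close> at the scale of the cover.\<close>

definition cozero_graph ::
    "'a topology \<Rightarrow> ('a \<Rightarrow> 'a) \<Rightarrow> 'i set \<Rightarrow> ('i \<Rightarrow> 'a \<Rightarrow> real) \<Rightarrow> 'i graph" where
  "cozero_graph X \<tau> J h =
     \<lparr>verts = J,
      edges = {(i, j). i \<in> J \<and> j \<in> J \<and> (\<exists>x\<in>topspace X. h i x \<noteq> 0 \<and> h j (\<tau> x) \<noteq> 0)}\<rparr>"

lemma Z2_space_closed: "Z2_space X \<tau> \<Longrightarrow> x \<in> topspace X \<Longrightarrow> \<tau> x \<in> topspace X"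
  unfolding Z2_space_def using continuous_map_image_subset_topspace by fastforce

lemma finite_cozero_graph:
  assumes "Z2_space X \<tau>" "cozero_cover X J h"
  shows "finite_graph (cozero_graph X \<tau> J h)"
proof -
  have "\<exists>x\<in>topspace X. h j x \<noteq> 0 \<and> h i (\<tau> x) \<noteq> 0"
    if "x \<in> topspace X" "h i x \<noteq> 0" "h j (\<tau> x) \<noteq> 0" for x i j
    using that assms(1) by (intro bexI[of _ "\<tau> x"]) (auto simp: Z2_space_closed Z2_space_def)
  then show ?thesis
    using assms(2)
    by (auto simp: finite_graph_def cozero_graph_def cozero_cover_def intro!: symI)
qed

lemma cozero_cover_prod_topology:
  assumes "cozero_cover X J h" "cozero_cover Y K h'"
  shows "cozero_cover (prod_topology X Y) (J \<times> K) (\<lambda>(j, k) (x, y). h j x * h' k y)"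
proof -
  have "continuous_map (prod_topology X Y) euclideanreal (\<lambda>p. h j (fst p) * h' k (snd p))"
    if "j \<in> J" "k \<in> K" for j k
    using that assms unfolding cozero_cover_def
    by (intro continuous_map_real_mult continuous_map_compose[OF continuous_map_fst, unfolded o_def]
      continuous_map_compose[OF continuous_map_snd, unfolded o_def]) auto
  then show ?thesis
    using assms unfolding cozero_cover_def by (auto simp: case_prod_unfold)
qed

text \<open>A product of reals is nonzero exactly when both factors are, so an edge witness in
  \<open>X \<times> Y\<close> is a pair of independent edge witnesses in the factors.\<close>

lemma tensor_product_cozero_graph:
  "tensor_product (cozero_graph X \<tau> J h) (cozero_graph Y \<sigma> K h') =
     cozero_graph (prod_topology X Y) (map_prod \<tau> \<sigma>) (J \<times> K) (\<lambda>(j, k) (x, y). h j x * h' k y)"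
proof -
  have "(\<exists>p\<in>topspace X \<times> topspace Y. h j (fst p) * h' k (snd p) \<noteq> 0 \<and>
        h j' (\<tau> (fst p)) * h' k' (\<sigma> (snd p)) \<noteq> 0) \<longleftrightarrow>
      (\<exists>x\<in>topspace X. h j x \<noteq> 0 \<and> h j' (\<tau> x) \<noteq> 0) \<and>
      (\<exists>y\<in>topspace Y. h' k y \<noteq> 0 \<and> h' k' (\<sigma> y) \<noteq> 0)" for j k j' k'
    by force
  then show ?thesis
    unfolding tensor_product_def cozero_graph_def by (auto simp: case_prod_unfold)
qed

text \<open>A \<open>k\<close>-colouring gives \<open>k\<close> odd functions which at every point
  take both a positive and a negative value. They are never all equal, so their \<open>k - 1\<close>
  differences from the last one have no common zero, whence the dimension
  \<open>k - 2\<close>.\<close>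

lemma coloring_imp_Z2_map_to_sphere:
  assumes X: "Z2_space X \<tau>" and cover: "cozero_cover X J h" and "k \<ge> 1"
    and hom: "graph_hom (cozero_graph X \<tau> J h) (complete_graph k) c"
  obtains f where "Z2_map X \<tau> (sphere_top (int k - 2)) antipode f"
proof -
  \<comment> \<open>Squares prevent cancellation: \<open>p i\<close> is nonzero exactly on the union
    of the cozero sets of colour \<open>i\<close>.\<close>
  define p where "p i x = (\<Sum>j\<in>{j\<in>J. c j = i}. (h j x)\<^sup>2)" for i x
  define g where "g i x = p i x - p i (\<tau> x)" for i x
  have fin: "finite J" and h: "\<And>j. j \<in> J \<Longrightarrow> continuous_map X euclideanreal (h j)"
    using cover by (auto simp: cozero_cover_def)
  have contp: "continuous_map X euclideanreal (p i)" for i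
    unfolding p_def using fin h by (intro continuous_intros) auto
  have "continuous_map X X \<tau>"
    using X by (simp add: Z2_space_def)
  from continuous_map_compose[OF this contp]
  have contg: "continuous_map X euclideanreal (g i)" for i
    unfolding g_def using contp by (intro continuous_intros) (auto simp: o_def)
  have odd: "g i (\<tau> x) = - g i x" if "x \<in> topspace X" for i x
    using X that by (simp add: g_def Z2_space_def)
  have pos: "\<exists>i\<in>{1..k}. g i x > 0" if x: "x \<in> topspace X" for x
  proof -
    obtain j where j: "j \<in> J" "h j x \<noteq> 0"
      using cover x by (auto simp: cozero_cover_def)
    have "p (c j) x > 0"
      unfolding p_def using fin j by (intro sum_pos2[where i = j]) auto
    \<comment> \<open>Otherwise \<open>j\<close> and \<open>j'\<close> would be adjacent with equal
      colours; for \<open>j' = j\<close> this would be a loop.\<close>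
    moreover have "h j' (\<tau> x) = 0" if "j' \<in> J" "c j' = c j" for j'
      using hom j x that unfolding graph_hom_def cozero_graph_def complete_graph_def by fastforce
    then have "p (c j) (\<tau> x) = 0"
      unfolding p_def by (intro sum.neutral) auto
    moreover have "c j \<in> {1..k}"
      using hom j unfolding graph_hom_def cozero_graph_def complete_graph_def by auto
    ultimately show ?thesis
      by (auto simp: g_def intro!: bexI[of _ "c j"])
  qed
  have neg: "\<exists>i\<in>{1..k}. g i x < 0" if x: "x \<in> topspace X" for x
    using pos[OF Z2_space_closed[OF X x]] odd[OF x] by auto
  show thesis
  proof (cases "k = 1")
    case True
    \<comment> \<open>A single function cannot be both positive and negative at a point. With no
      points, any function is a map to the empty sphere of dimension -1.\<close>
    then have "topspace X = {}"
      using pos neg by fastforce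
    then show thesis
      using that[of undefined] by (simp add: Z2_map_def)
  next
    case False
    with \<open>k \<ge> 1\<close> have k: "int k - 2 = int (k - 2)" by simp
    define z where "z i x = g (Suc i) x - g k x" for i x
    have "\<exists>i\<le>k - 2. z i x \<noteq> 0" if x: "x \<in> topspace X" for x
    proof (rule ccontr)
      assume "\<not> ?thesis"
      then have "g (Suc i) x = g k x" if "i \<le> k - 2" for i
        using that by (auto simp: z_def)
      then have "g i x = g k x" if "i \<in> {1..k}" for i
        using that by (cases i; cases "i = k") auto
      moreover obtain i i' where "i \<in> {1..k}" "g i x > 0" "i' \<in> {1..k}" "g i' x < 0"
        using pos[OF x] neg[OF x] by blast
      ultimately show False
        by (metis less_asym)
    qed
    moreover have "continuous_map X euclideanreal (z i)" for i
      unfolding z_def by (rule continuous_map_diff[OF contg contg])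
    moreover have "z i (\<tau> x) = - z i x" if "x \<in> topspace X" for i x
      using odd that by (simp add: z_def)
    ultimately obtain f where "Z2_map X \<tau> (sphere_top (int (k - 2))) antipode f"
      using odd_functions_imp_Z2_map_to_sphere[of "k - 2" X z \<tau>] by blast
    then show thesis
      unfolding k[symmetric] by (rule that)
  qed
qed

section \<open>Fine covers of a product, and a cover of the sphere\<close>

lemma completely_regular_space_bump:
  assumes "completely_regular_space X" "openin X V" "x \<in> V"
  obtains f :: "'a \<Rightarrow> real"
  where "continuous_map X euclideanreal f" "f x \<noteq> 0" "\<And>z. z \<in> topspace X \<Longrightarrow> f z \<noteq> 0 \<Longrightarrow> z \<in> V"
proof -
  have "closedin X (topspace X - V)" "x \<in> topspace X - (topspace X - V)"
    using assms openin_subset by fastforce+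
  then obtain f where f: "continuous_map X euclideanreal f" "f x = 0" "f ` (topspace X - V) \<subseteq> {1}"
    using assms(1)[unfolded completely_regular_space_alt] by meson
  have "continuous_map X euclideanreal (\<lambda>z. 1 - f z)"
    using f(1) by (intro continuous_intros) auto
  moreover have "z \<in> V" if "z \<in> topspace X" "1 - f z \<noteq> 0" for z
    using f(3) that by auto
  ultimately show thesis
    using that[of "\<lambda>z. 1 - f z"] f(2) by simp
qed

lemma openin_cozero_set:
  fixes f :: "'a \<Rightarrow> real"
  assumes "continuous_map X euclideanreal f"
  shows "openin X {x \<in> topspace X. f x \<noteq> 0}"
  using openin_continuous_map_preimage[OF assms, of "- {0}"] by (simp add: open_Compl)

text \<open>The index \<open>{p \<in> F. x \<in> A p}\<close> of a point \<open>x\<close> names the intersection of all sides \<open>A p\<close>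
  containing it; whenever the rectangle \<open>A p \<times> B p\<close> contains \<open>(x, y)\<close>, it contains the product of the
  two intersections.\<close>

lemma fine_cozero_covers:
  fixes X :: "'a topology" and Y :: "'b topology"
  assumes compact: "compact_space X" "compact_space Y"
    and regular: "completely_regular_space X" "completely_regular_space Y"
    and W: "\<And>U. U \<in> W \<Longrightarrow> openin (prod_topology X Y) U" "topspace (prod_topology X Y) \<subseteq> \<Union>W"
  obtains J K :: "('a \<times> 'b) set set" and h h'
  where "cozero_cover X J h" "cozero_cover Y K h'"
    "\<And>j k. j \<in> J \<Longrightarrow> k \<in> K \<Longrightarrow> \<exists>U\<in>W. \<forall>x\<in>topspace X. \<forall>y\<in>topspace Y.
       h j x \<noteq> 0 \<longrightarrow> h' k y \<noteq> 0 \<longrightarrow> (x, y) \<in> U"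
proof -
  let ?P = "\<lambda>p a b U. U \<in> W \<and> continuous_map X euclideanreal a \<and> continuous_map Y euclideanreal b \<and>
    a (fst p) \<noteq> 0 \<and> b (snd p) \<noteq> 0 \<and>
    (\<forall>x\<in>topspace X. \<forall>y\<in>topspace Y. a x \<noteq> 0 \<longrightarrow> b y \<noteq> 0 \<longrightarrow> (x, y) \<in> U)"
  have "\<exists>a b U. ?P p a b U" if p: "p \<in> topspace (prod_topology X Y)" for p
  proof -
    obtain U where U: "U \<in> W" "p \<in> U"
      using W(2) p by blast
    then obtain A B where AB: "openin X A" "openin Y B" "fst p \<in> A" "snd p \<in> B" "A \<times> B \<subseteq> U"
      using W(1) unfolding openin_prod_topology_alt by (metis prod.collapse)
    obtain a where a: "continuous_map X euclideanreal a" "a (fst p) \<noteq> 0"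
      "\<And>x. x \<in> topspace X \<Longrightarrow> a x \<noteq> 0 \<Longrightarrow> x \<in> A"
      using completely_regular_space_bump[OF regular(1) AB(1,3)] by blast
    obtain b where b: "continuous_map Y euclideanreal b" "b (snd p) \<noteq> 0"
      "\<And>y. y \<in> topspace Y \<Longrightarrow> b y \<noteq> 0 \<Longrightarrow> y \<in> B"
      using completely_regular_space_bump[OF regular(2) AB(2,4)] by blast
    have "?P p a b U"
      using AB(5) U(1) a b by blast
    then show ?thesis by blast
  qed
  \<comment> \<open>Each point \<open>p\<close> receives a box around it, cut out by
    \<open>a p\<close> and \<open>b p\<close>, that lies in the single member \<open>u p\<close> of
    \<open>W\<close>.\<close>
  then obtain a b u where P: "\<And>p. p \<in> topspace (prod_topology X Y) \<Longrightarrow> ?P p (a p) (b p) (u p)"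
    by metis
  define A where "A p = {x\<in>topspace X. a p x \<noteq> 0}" for p
  define B where "B p = {y\<in>topspace Y. b p y \<noteq> 0}" for p
  have open_box: "openin (prod_topology X Y) (A p \<times> B p)" if "p \<in> topspace (prod_topology X Y)" for p
    using P[OF that] by (auto simp: A_def B_def openin_prod_Times_iff intro!: openin_cozero_set)
  have "p \<in> A p \<times> B p" if "p \<in> topspace (prod_topology X Y)" for p
    using P[OF that] that by (cases p) (auto simp: A_def B_def)
  then have "topspace (prod_topology X Y) \<subseteq> \<Union>((\<lambda>p. A p \<times> B p) ` topspace (prod_topology X Y))"
    by blast
  moreover have "compact_space (prod_topology X Y)"
    using compact by (simp add: compact_space_prod_topology)
  ultimately have "\<exists>\<F>. finite \<F> \<and> \<F> \<subseteq> (\<lambda>p. A p \<times> B p) ` topspace (prod_topology X Y) \<and>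
      topspace (prod_topology X Y) \<subseteq> \<Union>\<F>"
    using open_box by (intro compactinD) (auto simp: compact_space_def simp del: topspace_prod_topology)
  then obtain \<F> where \<F>: "finite \<F>" "\<F> \<subseteq> (\<lambda>p. A p \<times> B p) ` topspace (prod_topology X Y)"
    "topspace (prod_topology X Y) \<subseteq> \<Union>\<F>"
    by meson
  obtain F where F: "finite F" "F \<subseteq> topspace (prod_topology X Y)"
    "topspace (prod_topology X Y) \<subseteq> (\<Union>p\<in>F. A p \<times> B p)"
    using finite_subset_image[OF \<F>(1,2)] \<F>(3) by metis
  define J where "J = (\<lambda>x. {p\<in>F. x \<in> A p}) ` topspace X"
  define K where "K = (\<lambda>y. {p\<in>F. y \<in> B p}) ` topspace Y"
  \<comment> \<open>This product is nonzero exactly on the intersection of the \<open>A p\<close>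
    with \<open>p \<in> S\<close>. For empty \<open>S\<close> it is the constant 1, which covers
    \<open>X\<close> when \<open>Y\<close> is empty.\<close>
  define h where "h S x = (\<Prod>p\<in>S. a p x)" for S x
  define h' where "h' S y = (\<Prod>p\<in>S. b p y)" for S y
  have sub: "S \<subseteq> F" if "S \<in> J \<union> K" for S
    using that by (auto simp: J_def K_def)
  then have fin: "finite S" if "S \<in> J \<union> K" for S
    using that F(1) finite_subset by blast
  have "finite J" "finite K"
    using sub F(1) by (auto intro: finite_subset[of _ "Pow F"])
  moreover have "continuous_map X euclideanreal (h S)" if "S \<in> J" for S
    unfolding h_def using that fin[of S] sub[of S] F(2) P by (intro continuous_intros) blast+
  moreover have "continuous_map Y euclideanreal (h' S)" if "S \<in> K" for S
    unfolding h'_def using that fin[of S] sub[of S] F(2) P by (intro continuous_intros) blast+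
  moreover have "\<exists>S\<in>J. h S x \<noteq> 0" if "x \<in> topspace X" for x
    using that F(1) by (auto simp: J_def h_def A_def)
  moreover have "\<exists>S\<in>K. h' S y \<noteq> 0" if "y \<in> topspace Y" for y
    using that F(1) by (auto simp: K_def h'_def B_def)
  ultimately have covers: "cozero_cover X J h" "cozero_cover Y K h'"
    by (auto simp: cozero_cover_def)
  have "\<exists>U\<in>W. \<forall>x\<in>topspace X. \<forall>y\<in>topspace Y. h S x \<noteq> 0 \<longrightarrow> h' T y \<noteq> 0 \<longrightarrow> (x, y) \<in> U"
    if S: "S \<in> J" and T: "T \<in> K" for S T
  proof -
    obtain x0 y0 where 0: "x0 \<in> topspace X" "S = {p\<in>F. x0 \<in> A p}"
      "y0 \<in> topspace Y" "T = {p\<in>F. y0 \<in> B p}"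
      using S T by (auto simp: J_def K_def)
    \<comment> \<open>The points defining the two indices lie in a common box
      \<open>A p \<times> B p\<close>; its \<open>p\<close> belongs to both \<open>S\<close> and
      \<open>T\<close>, so \<open>u p\<close> contains the whole product of the two sets.\<close>
    then have "(x0, y0) \<in> (\<Union>p\<in>F. A p \<times> B p)"
      using F(3) by auto
    then obtain p where p: "p \<in> F" "p \<in> S" "p \<in> T"
      using 0 by auto
    have "a p x \<noteq> 0" if "h S x \<noteq> 0" for x
      using that p fin[of S] S by (auto simp: h_def)
    moreover have "b p y \<noteq> 0" if "h' T y \<noteq> 0" for y
      using that p fin[of T] T by (auto simp: h'_def)
    moreover have "?P p (a p) (b p) (u p)"
      using P p(1) F(2) by blast
    ultimately show ?thesis
      by (intro bexI[of _ "u p"]) simp_all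
  qed
  with covers that show thesis by blast
qed

text \<open>The \<open>m + 2\<close> coordinates \<open>x\<^sub>0, \<dots>, x\<^sub>m, - (x\<^sub>0 + \<dots> + x\<^sub>m)\<close> sum to zero, so one of them
  is positive at each point of the sphere.\<close>

lemma sphere_antipodal_free_cover:
  obtains V :: "nat \<Rightarrow> (nat \<Rightarrow> real) set"
  where "\<And>i. openin (sphere_top (int m)) (V i)"
    "topspace (sphere_top (int m)) \<subseteq> (\<Union>i\<in>{1..m + 2}. V i)"
    "\<And>i x. x \<in> V i \<Longrightarrow> antipode x \<notin> V i"
proof -
  let ?S = "nsphere m"
  \<comment> \<open>Colours start at 1, so coordinate \<open>j\<close> gets index
    \<open>j + 1\<close>, and index \<open>m + 2\<close> gets the negated sum.\<close>
  define y where "y i x = (if i \<le> Suc m then x (i - 1) else - (\<Sum>j\<le>m. x j))" for i and x :: "nat \<Rightarrow> real"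
  define V where "V i = {x\<in>topspace ?S. y i x \<in> {0<..}}" for i
  have "continuous_map ?S euclideanreal (y i)" for i
    unfolding y_def
    by (cases "i \<le> Suc m")
       (auto simp del: continuous_map_minus_eq
         intro!: continuous_intros continuous_map_nsphere_projection)
  then have "openin ?S (V i)" for i
    unfolding V_def by (intro openin_continuous_map_preimage) auto
  moreover have "\<exists>i\<in>{1..m + 2}. x \<in> V i" if x: "x \<in> topspace ?S" for x
  proof (rule ccontr)
    assume "\<not> ?thesis"
    then have y: "y i x \<le> 0" if "i \<in> {1..m + 2}" for i
      using x that by (auto simp: V_def not_less)
    have neg: "x j \<le> 0" if "j \<le> m" for j
      using y[of "Suc j"] that by (simp add: y_def)
    \<comment> \<open>The sum is at most 0 by the first coordinates and at least 0 by the last one;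
      nonpositive terms with sum 0 vanish, which contradicts norm 1.\<close>
    then have "(\<Sum>j\<le>m. x j) = 0"
      using y[of "m + 2"] sum_nonpos[of "{..m}" x] by (simp add: y_def)
    then have "x j = 0" if "j \<le> m" for j
      using neg that sum_nonneg_eq_0_iff[of "{..m}" "\<lambda>j. - x j"] by (auto simp: sum_negf)
    then show False
      using x by (simp add: nsphere)
  qed
  moreover have "antipode x \<notin> V i" if "x \<in> V i" for x i
    using that by (auto simp: V_def y_def antipode_def sum_negf split: if_splits)
  ultimately show thesis
    by (intro that[of V]) (auto simp: sphere_top_def)
qed

section \<open>From the chromatic numbers of cover graphs to the index\<close>

lemma graph_hom_complete_graph_mono:
  assumes "graph_hom G (complete_graph m) c" "m \<le> n"
  shows "graph_hom G (complete_graph n) c"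
  using assms unfolding graph_hom_def complete_graph_def by fastforce

lemma hedetniemi_at_imp_index_le:
  assumes hed: "hedetniemi_at (m + 2)"
    and Z2: "Z2_space X \<tau>" "Z2_space Y \<sigma>"
    and compact: "compact_space X" "compact_space Y"
    and Hausdorff: "Hausdorff_space X" "Hausdorff_space Y"
    and ind: "Z2_index (prod_topology X Y) (map_prod \<tau> \<sigma>) = ereal (of_int (int m))"
  shows "min (Z2_index X \<tau>) (Z2_index Y \<sigma>) \<le> ereal (of_int (int m))"
proof -
  have completely_regular: "completely_regular_space X" "completely_regular_space Y"
    using compact Hausdorff by (simp_all add: compact_Hausdorff_imp_completely_regular_space)
  let ?XY = "prod_topology X Y" and ?\<rho> = "map_prod \<tau> \<sigma>"
  obtain f where f: "Z2_map ?XY ?\<rho> (sphere_top (int m)) antipode f"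
    using ind unfolding Z2_index_eq_iff by blast
  then have fcont: "continuous_map ?XY (sphere_top (int m)) f"
    by (simp add: Z2_map_def)
  obtain V :: "nat \<Rightarrow> (nat \<Rightarrow> real) set"
    where V: "\<And>i. openin (sphere_top (int m)) (V i)"
      "topspace (sphere_top (int m)) \<subseteq> (\<Union>i\<in>{1..m + 2}. V i)"
      "\<And>i x. x \<in> V i \<Longrightarrow> antipode x \<notin> V i"
    using sphere_antipodal_free_cover[of m] by blast
  define U where "U i = {p\<in>topspace ?XY. f p \<in> V i}" for i
  have Uopen: "openin ?XY (U i)" for i
    unfolding U_def using fcont V(1) by (rule openin_continuous_map_preimage)
  have Ucover: "topspace ?XY \<subseteq> \<Union>(U ` {1..m + 2})"
    using V(2) continuous_map_image_subset_topspace[OF fcont] by (fastforce simp: U_def)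
  have openU: "openin ?XY W" if "W \<in> U ` {1..m + 2}" for W
    using that Uopen by blast
  obtain J K :: "('a \<times> 'b) set set" and h h'
    where covers: "cozero_cover X J h" "cozero_cover Y K h'"
      and fine: "\<And>j k. j \<in> J \<Longrightarrow> k \<in> K \<Longrightarrow> \<exists>W\<in>U ` {1..m + 2}. \<forall>x\<in>topspace X. \<forall>y\<in>topspace Y.
        h j x \<noteq> 0 \<longrightarrow> h' k y \<noteq> 0 \<longrightarrow> (x, y) \<in> W"
    by (rule fine_cozero_covers[OF compact completely_regular openU Ucover]) (assumption, rule that)
  let ?G = "cozero_graph X \<tau> J h" and ?H = "cozero_graph Y \<sigma> K h'"
  have "\<exists>i\<in>{1..m + 2}. \<forall>x\<in>topspace X. \<forall>y\<in>topspace Y.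
      h (fst p) x \<noteq> 0 \<longrightarrow> h' (snd p) y \<noteq> 0 \<longrightarrow> (x, y) \<in> U i" if "p \<in> J \<times> K" for p
    using fine[of "fst p" "snd p"] that by auto
  then obtain c where c: "\<And>p. p \<in> J \<times> K \<Longrightarrow> c p \<in> {1..m + 2}"
    "\<And>p x y. p \<in> J \<times> K \<Longrightarrow> x \<in> topspace X \<Longrightarrow> y \<in> topspace Y \<Longrightarrow>
      h (fst p) x \<noteq> 0 \<Longrightarrow> h' (snd p) y \<noteq> 0 \<Longrightarrow> (x, y) \<in> U (c p)"
    by metis
  \<comment> \<open>An edge provides a point whose image lies in the \<open>V\<close> set of the
    first colour while the antipode of that image lies in that of the second; no \<open>V i\<close>
    contains an antipodal pair.\<close>
  have "c (j, k) \<noteq> c (j', k')"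
    if jk: "(j, k) \<in> J \<times> K" "(j', k') \<in> J \<times> K" and xy: "x \<in> topspace X" "y \<in> topspace Y"
      and nz: "h j x \<noteq> 0" "h j' (\<tau> x) \<noteq> 0" "h' k y \<noteq> 0" "h' k' (\<sigma> y) \<noteq> 0" for j k j' k' x y
  proof -
    have "f (x, y) \<in> V (c (j, k))"
      using c(2)[OF jk(1) xy] nz by (simp add: U_def)
    moreover have "f (\<tau> x, \<sigma> y) \<in> V (c (j', k'))"
      using c(2)[OF jk(2), of "\<tau> x" "\<sigma> y"] nz xy Z2 by (simp add: U_def Z2_space_closed)
    moreover have "f (\<tau> x, \<sigma> y) = antipode (f (x, y))"
      using f xy by (auto simp: Z2_map_def)
    ultimately show ?thesis
      using V(3) by metis
  qed
  then have upper: "graph_hom (tensor_product ?G ?H) (complete_graph (m + 2)) c"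
    using c(1) unfolding graph_hom_def tensor_product_def cozero_graph_def complete_graph_def
    by auto
  have lower: "\<nexists>c. graph_hom (tensor_product ?G ?H) (complete_graph l) c" if "l < m + 2" for l
  proof
    assume "\<exists>c. graph_hom (tensor_product ?G ?H) (complete_graph l) c"
    \<comment> \<open>Raising \<open>l\<close> to at least 1 meets the bound
      \<open>k \<ge> 1\<close> of the colouring lemma. The resulting sphere still has dimension
      below \<open>m\<close>, since \<open>m \<ge> 0\<close> exceeds -1.\<close>
    then obtain c where "graph_hom (tensor_product ?G ?H) (complete_graph (max 1 l)) c"
      using graph_hom_complete_graph_mono by (metis max.cobounded2)
    then obtain g where "Z2_map ?XY ?\<rho> (sphere_top (int (max 1 l) - 2)) antipode g"
      unfolding tensor_product_cozero_graph
      using coloring_imp_Z2_map_to_sphere[OF Z2_space_prod_topology[OF Z2]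
          cozero_cover_prod_topology[OF covers]] by (metis max.cobounded1)
    then show False
      using ind that unfolding Z2_index_eq_iff by (auto simp: max_def split: if_splits)
  qed
  have "chromatic_number (tensor_product ?G ?H) = enat (m + 2)"
    using upper lower unfolding chromatic_number_eq_iff by blast
  \<comment> \<open>The vertices are sets of pairs of points, so the form of the hypothesis for
    arbitrary vertex types is used.\<close>
  then have "min (chromatic_number ?G) (chromatic_number ?H) = enat (m + 2)"
    using hedetniemi_at_any_type[OF hed] finite_cozero_graph Z2 covers by metis
  then consider "chromatic_number ?G = enat (m + 2)" | "chromatic_number ?H = enat (m + 2)"
    by (metis min_def)
  then show ?thesis
  proof cases
    case 1
    then obtain c where "graph_hom ?G (complete_graph (m + 2)) c"
      by (auto simp: chromatic_number_eq_iff)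
    then obtain g where "Z2_map X \<tau> (sphere_top (int (m + 2) - 2)) antipode g"
      using coloring_imp_Z2_map_to_sphere[OF Z2(1) covers(1)] by (metis le_add2 one_le_numeral order_trans)
    then show ?thesis
      using Z2_index_le[of X \<tau> "int m"] by (simp add: min.coboundedI1)
  next
    case 2
    then obtain c where "graph_hom ?H (complete_graph (m + 2)) c"
      by (auto simp: chromatic_number_eq_iff)
    then obtain g where "Z2_map Y \<sigma> (sphere_top (int (m + 2) - 2)) antipode g"
      using coloring_imp_Z2_map_to_sphere[OF Z2(2) covers(2)] by (metis le_add2 one_le_numeral order_trans)
    then show ?thesis
      using Z2_index_le[of Y \<sigma> "int m"] by (simp add: min.coboundedI2)
  qed
qed

text \<open>A map to the empty sphere has empty domain, and an empty product has an empty factor.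
  This is the case \<open>n = 1\<close>, below the range of the graph argument.\<close>

lemma Z2_index_prod_eq_minus_one:
  assumes "Z2_index (prod_topology X Y) (map_prod \<tau> \<sigma>) = ereal (of_int (-1))"
  shows "min (Z2_index X \<tau>) (Z2_index Y \<sigma>) \<le> ereal (of_int (-1))"
proof -
  have "prod_topology X Y = trivial_topology"
    using assms unfolding Z2_index_eq_iff by (auto simp: Z2_map_def sphere_top_def)
  then consider "X = trivial_topology" | "Y = trivial_topology"
    by auto
  then show ?thesis
  proof cases
    case 1
    then have "Z2_map X \<tau> (sphere_top (-1)) antipode undefined"
      by (simp add: Z2_map_def)
    from Z2_index_le[OF this] show ?thesis
      by (simp add: min.coboundedI1)
  next
    case 2
    then have "Z2_map Y \<sigma> (sphere_top (-1)) antipode undefined"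
      by (simp add: Z2_map_def)
    from Z2_index_le[OF this] show ?thesis
      by (simp add: min.coboundedI2)
  qed
qed

lemma hedetniemi_at_imp_index_hedetniemi_at:
  assumes "n \<ge> 1" "hedetniemi_at n"
  shows "index_hedetniemi_at TYPE('a) TYPE('b) (int n - 2)"
  unfolding index_hedetniemi_at_def
proof (intro allI impI)
  fix X :: "'a topology" and \<tau> and Y :: "'b topology" and \<sigma>
  assume X: "finite_Z2_CW_complex X \<tau>" and Y: "finite_Z2_CW_complex Y \<sigma>"
    and ind: "Z2_index (prod_topology X Y) (map_prod \<tau> \<sigma>) = ereal (of_int (int n - 2))"
  have "min (Z2_index X \<tau>) (Z2_index Y \<sigma>) \<le> ereal (of_int (int n - 2))"
  proof (cases "n = 1")
    case True
    then show ?thesis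
      using Z2_index_prod_eq_minus_one[of X Y \<tau> \<sigma>] ind by simp
  next
    case False
    with \<open>n \<ge> 1\<close> obtain m where "n = m + 2"
      by (metis add.commute le_Suc_ex nat_less_le one_add_one plus_1_eq_Suc Suc_leI)
    then show ?thesis
      using hedetniemi_at_imp_index_le[of m X \<tau> Y \<sigma>] assms(2) ind X Y
        compact_space_finite_Z2_CW_complex[OF X] compact_space_finite_Z2_CW_complex[OF Y]
      by (simp add: finite_Z2_CW_complex_def)
  qed
  then show "min (Z2_index X \<tau>) (Z2_index Y \<sigma>) = ereal (of_int (int n - 2))"
    using Z2_index_prod_le[of X Y \<tau> \<sigma>] ind by (metis antisym)
qed

theorem theorem1p2:
  shows "(\<forall>n::nat. n \<ge> 1 \<longrightarrow> hedetniemi_at n \<longrightarrow>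
            index_hedetniemi_at TYPE('a) TYPE('b) (int n - 2)) \<and>
         (hedetniemi_conjecture \<longrightarrow>
            (\<forall>(X :: 'a topology) \<tau> (Y :: 'b topology) \<sigma>.
               finite_Z2_CW_complex X \<tau> \<longrightarrow> finite_Z2_CW_complex Y \<sigma> \<longrightarrow>
               Z2_index (prod_topology X Y) (map_prod \<tau> \<sigma>) = min (Z2_index X \<tau>) (Z2_index Y \<sigma>)))"
proof (intro conjI allI impI)
  fix n :: nat
  assume "n \<ge> 1" "hedetniemi_at n"
  then show "index_hedetniemi_at TYPE('a) TYPE('b) (int n - 2)"
    by (rule hedetniemi_at_imp_index_hedetniemi_at)
next
  fix X :: "'a topology" and \<tau> and Y :: "'b topology" and \<sigma>
  assume hed: "hedetniemi_conjecture"
    and X: "finite_Z2_CW_complex X \<tau>" and Y: "finite_Z2_CW_complex Y \<sigma>"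
  let ?i = "Z2_index (prod_topology X Y) (map_prod \<tau> \<sigma>)"
  have "hedetniemi_at n" for n
    using hed unfolding hedetniemi_conjecture_def hedetniemi_at_def by metis
  then have at: "index_hedetniemi_at TYPE('a) TYPE('b) (int n - 2)" if "n \<ge> 1" for n
    using that by (rule hedetniemi_at_imp_index_hedetniemi_at[rotated])
  show "?i = min (Z2_index X \<tau>) (Z2_index Y \<sigma>)"
  proof (cases rule: Z2_index_cases[of "prod_topology X Y" "map_prod \<tau> \<sigma>"])
    case (1 m)
    \<comment> \<open>Here \<open>n = m + 2\<close>, which is at least 1 because
      \<open>m \<ge> -1\<close>.\<close>
    then have "index_hedetniemi_at TYPE('a) TYPE('b) m"
      using at[of "nat (m + 2)"] by simp
    with 1 X Y show ?thesis
      unfolding index_hedetniemi_at_def by metis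
  next
    case 2
    \<comment> \<open>The projections bound the index of the product by the minimum, so an infinite
      index of the product makes both indices infinite.\<close>
    with Z2_index_prod_le[of X Y \<tau> \<sigma>] show ?thesis
      by simp
  qed
qed

end
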